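(* Fix $d\ge 2$. If $BT_d(h,k)\in\mathbf{L}$ (resp. $\in\mathbf{NL}$), then there are a constant $c_d$ and a function $f_d$ such that $\#\mathrm{detFstates}^h_d(k)\le f_d(h)k^{c_d}$ (resp. $\#\mathrm{ndetFstates}^h_d(k)\le f_d(h)k^{c_d}$) for all $h,k\ge 2$.
   Context: $T^h_d$ is the balanced rooted $d$-ary tree with $h$ levels. An instance with parameter $k$ assigns to each internal node $i$ a function $f_i:[k]^d\to[k]$ (given by its $k^d$ values) and to each leaf an element of $[k]=\{1,\dots,k\}$; $v_i$ is the leaf label for a leaf and $v_i=f_i(v_{j_1},\dots,v_{j_d})$ for an internal node with children $j_1,\dots,j_d$. $FT^h_d(k)$: output the root value; its $k$-ary input variables are $f_i(x)$ (internal $i$, $x\in[k]^d$) and one per leaf. $BT_d(h,k)$ is the language of binary strings encoding $h,k$, all node functions (as $k^d$ binary numbers each) and leaf values, whose root value is $1$. A nondeterministic $k$-way branching program computing $g:[k]^m\to R$ is a directed rooted multigraph of states, edges labelled by elements of $[k]$, nonfinal states labelled by variable indices in $[m]$, and $|R|$ final sink states labelled by elements of $R$; on input $x$, edges labelled $x_j$ out of states labelled $j$ are activated; each computation (path of activated edges from the root) is infinite, ends in the final state labelled $g(x)$, or aborts at a state labelled $j$ with no outedge labelled $x_j$, and at least one ends in a final state. It is deterministic if every nonfinal state has exactly $k$ outedges labelled $1,\dots,k$. $\#\mathrm{detFstates}^h_d(k)$ (resp. $\#\mathrm{ndetFstates}^h_d(k)$) is the minimum number of states of a deterministic (resp. nondeterministic)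 $k$-way branching program computing $FT^h_d(k)$. *)

theory Defs
  imports Complex_Main "HOL-Library.FuncSet" "HOL-Library.Landau_Symbols" "HOL-Library.Log_Nat"
    "Graph_Theory.Arc_Walk"
begin

section \<open>Logarithmic space\<close>

text \<open>
  Turing machines with a two-way read-only input tape carrying a binary string between end
  markers, and one read-write work tape, infinite to the right.  States and work symbols are
  natural numbers, 0 being the blank symbol.  An element
  \<open>((q, a, b), (q', b', m, m'))\<close> of \<open>transitions\<close> says: in state \<open>q\<close>,
  reading \<open>a\<close> on the input tape and \<open>b\<close> on the work tape, the machine may go to
  state \<open>q'\<close>, write \<open>b'\<close> on the work tape, and move its input head by \<open>m\<close>
  and its work head by \<open>m'\<close>.  Finiteness of this relation makes the state set and the work
  alphabet finite.
\<close>

datatype input_symbol = Left_End | Bit bool | Right_End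

datatype head_move = Move_Left | Stay | Move_Right

record turing_machine =
  start_state :: nat
  accept_state :: nat
  transitions :: "((nat \<times> input_symbol \<times> nat) \<times> (nat \<times> nat \<times> head_move \<times> head_move)) set"

text \<open>State, input head position, work tape contents, work head position.\<close>

type_synonym tm_config = "nat \<times> nat \<times> (nat \<Rightarrow> nat) \<times> nat"

definition wf_tm :: "turing_machine \<Rightarrow> bool" where
  "wf_tm M \<longleftrightarrow> finite (transitions M) \<and>
     (\<forall>((q, a, b), t) \<in> transitions M. q \<noteq> accept_state M)"

definition input_at :: "bool list \<Rightarrow> nat \<Rightarrow> input_symbol" where
  "input_at w i = (if i = 0 then Left_End else if i \<le> length w then Bit (w ! (i - 1)) else Right_End)"

fun move_head :: "head_move \<Rightarrow> nat \<Rightarrow> nat" where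
  "move_head Move_Left i = i - 1"
| "move_head Stay i = i"
| "move_head Move_Right i = i + 1"

definition tm_init :: "turing_machine \<Rightarrow> tm_config" where
  "tm_init M = (start_state M, 0, (\<lambda>_. 0), 0)"

text \<open>A head that would leave the left end of its tape, or an input head that would leave the
  right end marker, stays where it is.\<close>

inductive tm_step :: "turing_machine \<Rightarrow> bool list \<Rightarrow> tm_config \<Rightarrow> tm_config \<Rightarrow> bool"
  for M :: turing_machine and w :: "bool list" where
  "((q, input_at w i, T j), (q', b', m, m')) \<in> transitions M \<Longrightarrow>
   tm_step M w (q, i, T, j)
     (q', min (move_head m i) (length w + 1), T(j := b'), move_head m' j)"

definition tm_reaches :: "turing_machine \<Rightarrow> bool list \<Rightarrow> tm_config \<Rightarrow> bool" where
  "tm_reaches M w c \<longleftrightarrow> (tm_step M w)\<^sup>*\<^sup>* (tm_init M) c"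

definition tm_accepts :: "turing_machine \<Rightarrow> bool list \<Rightarrow> bool" where
  "tm_accepts M w \<longleftrightarrow> (\<exists>c. tm_reaches M w c \<and> fst c = accept_state M)"

definition tm_halts :: "turing_machine \<Rightarrow> bool list \<Rightarrow> bool" where
  "tm_halts M w \<longleftrightarrow>
     \<not> (\<exists>c :: nat \<Rightarrow> tm_config. c 0 = tm_init M \<and> (\<forall>n. tm_step M w (c n) (c (Suc n))))"

text \<open>Only work tape cells count, and the bound applies to all computation branches on all inputs.\<close>

definition tm_space_bounded :: "turing_machine \<Rightarrow> (nat \<Rightarrow> nat) \<Rightarrow> bool" where
  "tm_space_bounded M s \<longleftrightarrow>
     (\<forall>w q i T j. tm_reaches M w (q, i, T, j) \<longrightarrow> j < s (length w))"

definition log_space_tm :: "turing_machine \<Rightarrow> bool" where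
  "log_space_tm M \<longleftrightarrow> wf_tm M \<and>
     (\<exists>s. tm_space_bounded M s \<and> (\<lambda>n. real (s n)) \<in> O(\<lambda>n. ln (real n)))"

definition LOGSPACE :: "bool list set set" where
  "LOGSPACE = {A. \<exists>M. log_space_tm M \<and> single_valued (transitions M) \<and>
     (\<forall>w. tm_halts M w \<and> (tm_accepts M w \<longleftrightarrow> w \<in> A))}"

text \<open>Rejecting branches of a nondeterministic machine may run forever.\<close>

definition NLOGSPACE :: "bool list set set" where
  "NLOGSPACE = {A. \<exists>M. log_space_tm M \<and> (\<forall>w. tm_accepts M w \<longleftrightarrow> w \<in> A)}"


section \<open>Tree evaluation\<close>

text \<open>
  A node of the balanced \<open>d\<close>-ary tree with \<open>h\<close> levels is given by the path leading to it
  from the root, a list of length less than \<open>h\<close> over \<open>{0..<d}\<close>; the children of \<open>p\<close>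
  are \<open>p @ [0], \<dots>, p @ [d - 1]\<close>.
\<close>

type_synonym node = "nat list"

definition level_nodes :: "nat \<Rightarrow> nat \<Rightarrow> node list" where
  "level_nodes d l = product_lists (replicate l [0..<d])"

definition internal_nodes :: "nat \<Rightarrow> nat \<Rightarrow> node list" where
  "internal_nodes d h = concat (map (level_nodes d) [0..<h - 1])"

definition leaves :: "nat \<Rightarrow> nat \<Rightarrow> node list" where
  "leaves d h = level_nodes d (h - 1)"

text \<open>The variable \<open>Fun_Var p a\<close> is the value at \<open>a\<close> of the function of the internal node
  \<open>p\<close>.\<close>

datatype tree_var = Fun_Var node "nat list" | Leaf_Var node

definition tree_vars :: "nat \<Rightarrow> nat \<Rightarrow> nat \<Rightarrow> tree_var list" where
  "tree_vars d h k =
     concat (map (\<lambda>p. map (Fun_Var p) (product_lists (replicate d [1..<k + 1]))) (internal_nodes d h))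
     @ map Leaf_Var (leaves d h)"

text \<open>An instance is an assignment of elements of \<open>[k]\<close> to the variables.\<close>

definition tree_instances :: "nat \<Rightarrow> nat \<Rightarrow> nat \<Rightarrow> (tree_var \<Rightarrow> nat) set" where
  "tree_instances d h k = (set (tree_vars d h k) \<rightarrow>\<^sub>E {1..k})"

text \<open>The value of node \<open>p\<close> when there are \<open>l\<close> levels below it.\<close>

primrec node_value :: "nat \<Rightarrow> (tree_var \<Rightarrow> nat) \<Rightarrow> nat \<Rightarrow> node \<Rightarrow> nat" where
  "node_value d x 0 p = x (Leaf_Var p)"
| "node_value d x (Suc l) p = x (Fun_Var p (map (\<lambda>j. node_value d x l (p @ [j])) [0..<d]))"

definition FT :: "nat \<Rightarrow> nat \<Rightarrow> (tree_var \<Rightarrow> nat) \<Rightarrow> nat" where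
  "FT d h x = node_value d x (h - 1) []"

text \<open>
  The \<open>n\<close>-bit binary representation, most significant bit first.  \<open>floorlog 2 k\<close> is the length
  of the binary representation of \<open>k\<close>; all elements of \<open>[k]\<close> are padded to that length.
  The parameters \<open>h\<close> and \<open>k\<close> are made self-delimiting by doubling each bit and appending 01.
\<close>

definition binary :: "nat \<Rightarrow> nat \<Rightarrow> bool list" where
  "binary n m = map (bit m) (rev [0..<n])"

definition encode_param :: "nat \<Rightarrow> bool list" where
  "encode_param m = concat (map (\<lambda>b. [b, b]) (binary (floorlog 2 m) m)) @ [False, True]"

definition encode_instance :: "nat \<Rightarrow> nat \<Rightarrow> nat \<Rightarrow> (tree_var \<Rightarrow> nat) \<Rightarrow> bool list" where
  "encode_instance d h k x =
     encode_param h @ encode_param k @ concat (map (\<lambda>v. binary (floorlog 2 k) (x v)) (tree_vars d h k))"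

definition BT :: "nat \<Rightarrow> bool list set" where
  "BT d = {encode_instance d h k x | h k x.
     1 \<le> h \<and> 1 \<le> k \<and> x \<in> tree_instances d h k \<and> FT d h x = 1}"


section \<open>Branching programs\<close>

datatype ('v, 'r) state_label = Query 'v | Final 'r

text \<open>The vertices of \<open>bp_graph\<close> are the states; states and edges are named by natural numbers.
  Final states are labelled by outputs, all other states by input variables.\<close>

record ('v, 'r) branching_program =
  bp_graph :: "(nat, nat) pre_digraph"
  bp_root :: nat
  bp_label :: "nat \<Rightarrow> ('v, 'r) state_label"
  bp_edge_label :: "nat \<Rightarrow> nat"

definition is_branching_program ::
    "nat \<Rightarrow> 'v set \<Rightarrow> 'r set \<Rightarrow> ('v, 'r) branching_program \<Rightarrow> bool" where
  "is_branching_program k V R B \<longleftrightarrow>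
     fin_digraph (bp_graph B) \<and> bp_root B \<in> verts (bp_graph B) \<and>
     (\<forall>e \<in> arcs (bp_graph B). bp_edge_label B e \<in> {1..k}) \<and>
     (\<forall>s \<in> verts (bp_graph B). bp_label B s \<in> Query ` V \<union> Final ` R) \<and>
     (\<forall>r \<in> R. \<exists>!s. s \<in> verts (bp_graph B) \<and> bp_label B s = Final r) \<and>
     (\<forall>s \<in> verts (bp_graph B). \<forall>r. bp_label B s = Final r \<longrightarrow> out_arcs (bp_graph B) s = {})"

definition activated :: "('v, 'r) branching_program \<Rightarrow> ('v \<Rightarrow> nat) \<Rightarrow> nat \<Rightarrow> bool" where
  "activated B x e \<longleftrightarrow> e \<in> arcs (bp_graph B) \<and>
     (\<exists>v. bp_label B (tail (bp_graph B) e) = Query v \<and> bp_edge_label B e = x v)"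

text \<open>The endpoints of the finite computations, that is, of the finite paths of activated edges from
  the root that cannot be continued.\<close>

definition computation_ends_in ::
    "('v, 'r) branching_program \<Rightarrow> ('v \<Rightarrow> nat) \<Rightarrow> nat \<Rightarrow> bool" where
  "computation_ends_in B x s \<longleftrightarrow>
     (\<exists>p. pre_digraph.awalk (bp_graph B) (bp_root B) p s \<and> (\<forall>e \<in> set p. activated B x e)) \<and>
     (\<forall>e \<in> out_arcs (bp_graph B) s. \<not> activated B x e)"

definition aborts_at :: "('v, 'r) branching_program \<Rightarrow> ('v \<Rightarrow> nat) \<Rightarrow> nat \<Rightarrow> bool" where
  "aborts_at B x s \<longleftrightarrow> (\<exists>v. bp_label B s = Query v \<and>
     (\<forall>e \<in> out_arcs (bp_graph B) s. bp_edge_label B e \<noteq> x v))"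

definition bp_computes ::
    "nat \<Rightarrow> 'v set \<Rightarrow> 'r set \<Rightarrow> (('v \<Rightarrow> nat) \<Rightarrow> 'r) \<Rightarrow> ('v, 'r) branching_program \<Rightarrow> bool" where
  "bp_computes k V R g B \<longleftrightarrow> is_branching_program k V R B \<and>
     (\<forall>x \<in> V \<rightarrow>\<^sub>E {1..k}.
        (\<forall>s. computation_ends_in B x s \<longrightarrow> bp_label B s = Final (g x) \<or> aborts_at B x s) \<and>
        (\<exists>s r. computation_ends_in B x s \<and> bp_label B s = Final r))"

definition bp_deterministic :: "nat \<Rightarrow> ('v, 'r) branching_program \<Rightarrow> bool" where
  "bp_deterministic k B \<longleftrightarrow>
     (\<forall>s \<in> verts (bp_graph B). \<forall>v. bp_label B s = Query v \<longrightarrow>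
        bij_betw (bp_edge_label B) (out_arcs (bp_graph B) s) {1..k})"

definition num_states :: "('v, 'r) branching_program \<Rightarrow> nat" where
  "num_states B = card (verts (bp_graph B))"

definition detFstates :: "nat \<Rightarrow> nat \<Rightarrow> nat \<Rightarrow> nat" where
  "detFstates d h k = (LEAST n. \<exists>B. bp_computes k (set (tree_vars d h k)) {1..k} (FT d h) B \<and>
     bp_deterministic k B \<and> num_states B = n)"

definition ndetFstates :: "nat \<Rightarrow> nat \<Rightarrow> nat \<Rightarrow> nat" where
  "ndetFstates d h k = (LEAST n. \<exists>B. bp_computes k (set (tree_vars d h k)) {1..k} (FT d h) B \<and>
     num_states B = n)"

end

theory Submission
  imports Defs
begin

text \<open>
  Replacing the root function \<open>f\<close> by \<open>a \<mapsto> if f a = r then 1 else 2\<close> makes the root value 1 exactly if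
  it was \<open>r\<close>, so a machine for \<open>BT d\<close> decides whether \<open>FT d h x = r\<close>. For fixed \<open>h\<close> and \<open>k\<close> all
  encodings have the same length \<open>n\<close>, at most a function of \<open>h\<close> times a power of \<open>k\<close>, and each input
  cell depends on at most one variable. Hence the configurations of the machine on inputs of length
  \<open>n\<close>, of which there are polynomially many in \<open>n\<close>, serve as states of a branching program that
  queries the variable under the input head. A deterministic program tries \<open>r = 1, \<dots>, k\<close> in turn,
  which terminates because the machine halts; a nondeterministic one guesses \<open>r\<close>.
\<close>

section \<open>Branching programs from transition systems\<close>

text \<open>A triple \<open>(s, a, t)\<close> stands for an edge from \<open>s\<close> to
  \<open>t\<close> labelled \<open>a\<close>; the relation follows the edges that \<open>x\<close>
  activates.\<close>

definition query_step where
  "query_step E lab x s t \<longleftrightarrow> (\<exists>v. lab s = Query v \<and> (s, x v, t) \<in> E)"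

text \<open>Injections into the naturals name states and edges, and walks of activated edges
  correspond to \<open>query_step\<close> paths. Correctness is required at final states only: a
  computation ending at a querying state has no edge for the queried value and aborts. Determinism
  is a conditional conclusion so that one construction serves both kinds of program.\<close>

lemma branching_program_of_system:
  fixes S :: "'a set" and E :: "('a \<times> nat \<times> 'a) set"
    and lab :: "'a \<Rightarrow> ('v, 'r) state_label"
  assumes finS: "finite S" and root: "s0 \<in> S" and E: "E \<subseteq> S \<times> {1..k} \<times> S"
    and lab: "lab ` S \<subseteq> Query ` V \<union> Final ` R"
    and final_unique: "\<And>r. r \<in> R \<Longrightarrow> \<exists>!s. s \<in> S \<and> lab s = Final r"
    and final_sink: "\<And>s a t r. (s, a, t) \<in> E \<Longrightarrow> lab s \<noteq> Final r"
    and sound: "\<And>x s r. x \<in> V \<rightarrow>\<^sub>E {1..k} \<Longrightarrow> (query_step E lab x)\<^sup>*\<^sup>* s0 s \<Longrightarrow>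
      lab s = Final r \<Longrightarrow> r = g x"
    and complete: "\<And>x. x \<in> V \<rightarrow>\<^sub>E {1..k} \<Longrightarrow>
      \<exists>s r. (query_step E lab x)\<^sup>*\<^sup>* s0 s \<and> lab s = Final r"
  obtains B where "bp_computes k V R g B" "num_states B = card S"
    "(\<And>s v a. s \<in> S \<Longrightarrow> lab s = Query v \<Longrightarrow> a \<in> {1..k} \<Longrightarrow> \<exists>!t. (s, a, t) \<in> E)
      \<Longrightarrow> bp_deterministic k B"
proof -
  obtain f :: "'a \<Rightarrow> nat" where f: "inj_on f S"
    using finite_imp_inj_to_nat_seg[OF finS] by blast
  have finE: "finite E"
    using E finS by (meson finite_SigmaI finite_atLeastAtMost finite_subset)
  obtain e :: "'a \<times> nat \<times> 'a \<Rightarrow> nat" where e: "inj_on e E"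
    using finite_imp_inj_to_nat_seg[OF finE] by blast
  define G where "G = \<lparr>verts = f ` S, arcs = e ` E,
    tail = (\<lambda>n. f (fst (inv_into E e n))), head = (\<lambda>n. f (snd (snd (inv_into E e n))))\<rparr>"
  define B where "B = \<lparr>bp_graph = G, bp_root = f s0, bp_label = (\<lambda>n. lab (inv_into S f n)),
    bp_edge_label = (\<lambda>n. fst (snd (inv_into E e n)))\<rparr>"
  have B_simps [simp]: "bp_graph B = G" "bp_root B = f s0" "verts G = f ` S" "arcs G = e ` E"
    by (auto simp: B_def G_def)
  have lab_f [simp]: "bp_label B (f s) = lab s" if "s \<in> S" for s
    using that f by (simp add: B_def)
  have arc [simp]: "tail G (e (s, a, t)) = f s" "head G (e (s, a, t)) = f t"
      "bp_edge_label B (e (s, a, t)) = a" if "(s, a, t) \<in> E" for s a t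
    using that e by (simp_all add: B_def G_def)
  have in_S: "s \<in> S" "a \<in> {1..k}" "t \<in> S" if "(s, a, t) \<in> E" for s a t
    using that E by auto
  have f_eq: "f s = f t \<longleftrightarrow> s = t" if "s \<in> S" "t \<in> S" for s t
    using that f by (auto dest: inj_onD)
  have out: "out_arcs G (f s) = {e (s, a, t) | a t. (s, a, t) \<in> E}" if "s \<in> S" for s
  proof -
    have "y \<in> out_arcs G (f s) \<longleftrightarrow> (\<exists>z \<in> E. y = e z \<and> fst z = s)" for y
    proof -
      have "tail G (e z) = f s \<longleftrightarrow> fst z = s" if "z \<in> E" for z
        using that f_eq[of "fst z" s] in_S \<open>s \<in> S\<close> by (cases z) auto
      then show ?thesis by (auto simp: out_arcs_def)
    qed
    then show ?thesis by force
  qed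
  have is_bp: "is_branching_program k V R B"
    unfolding is_branching_program_def
  proof (intro conjI ballI allI impI)
    show "fin_digraph (bp_graph B)"
      by unfold_locales (use finS finE in_S in auto)
    show "bp_root B \<in> verts (bp_graph B)" using root by simp
    show "bp_edge_label B n \<in> {1..k}" if "n \<in> arcs (bp_graph B)" for n
      using that in_S(2) by auto
    show "bp_label B s \<in> Query ` V \<union> Final ` R" if "s \<in> verts (bp_graph B)" for s
      using that lab by auto
    show "\<exists>!s. s \<in> verts (bp_graph B) \<and> bp_label B s = Final r" if r: "r \<in> R" for r
    proof -
      from final_unique[OF r] obtain s
        where s: "s \<in> S \<and> lab s = Final r" and eq: "\<forall>t. t \<in> S \<and> lab t = Final r \<longrightarrow> t = s"
        by (rule ex1E)
      show ?thesis
      proof (rule ex1I[of _ "f s"])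
        fix n assume "n \<in> verts (bp_graph B) \<and> bp_label B n = Final r"
        then obtain t where "n = f t" "t \<in> S" "lab t = Final r" by auto
        then show "n = f s" using eq by blast
      qed (use s in simp)
    qed
    show "out_arcs (bp_graph B) s = {}"
      if "s \<in> verts (bp_graph B)" "bp_label B s = Final r" for s r
      using that final_sink by (auto simp: out)
  qed
  have activated: "activated B x (e (s, a, t)) \<longleftrightarrow> (\<exists>v. lab s = Query v \<and> a = x v)"
    if "(s, a, t) \<in> E" for x s a t
    using that in_S by (auto simp: activated_def)
  have walk_D: "\<exists>t \<in> S. n = f t \<and> (query_step E lab x)\<^sup>*\<^sup>* s t"
    if "pre_digraph.awalk G (f s) p n" "\<forall>a \<in> set p. activated B x a" "s \<in> S" for x s p n
    using that
  proof (induction p arbitrary: s)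
    case Nil
    then show ?case by (auto simp: pre_digraph.awalk_def pre_digraph.cas.simps)
  next
    case (Cons a p)
    from Cons.prems obtain u b t where a: "a = e (u, b, t)" "(u, b, t) \<in> E"
      by (auto simp: pre_digraph.awalk_def)
    with Cons.prems have "u = s"
      using in_S f_eq by (auto simp: pre_digraph.awalk_def pre_digraph.cas.simps)
    moreover have "pre_digraph.awalk G (f t) p n"
      using Cons.prems(1) a in_S by (auto simp: pre_digraph.awalk_def pre_digraph.cas.simps)
    ultimately obtain t' where "t' \<in> S" "n = f t'" "(query_step E lab x)\<^sup>*\<^sup>* t t'"
      using Cons.IH[of t] Cons.prems a in_S by auto
    moreover have "query_step E lab x s t"
      using Cons.prems(2) activated a \<open>u = s\<close> by (auto simp: query_step_def)
    ultimately show ?case by (blast intro: converse_rtranclp_into_rtranclp)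
  qed
  have walk_I: "\<exists>p. pre_digraph.awalk G (f s) p (f t) \<and> (\<forall>a \<in> set p. activated B x a)"
    if "(query_step E lab x)\<^sup>*\<^sup>* s t" "s \<in> S" for x s t
    using that
  proof (induction rule: converse_rtranclp_induct)
    case base
    then show ?case
      by (intro exI[of _ "[]"]) (auto simp: pre_digraph.awalk_def pre_digraph.cas.simps)
  next
    case (step s u)
    then obtain v where v: "lab s = Query v" "(s, x v, u) \<in> E" by (auto simp: query_step_def)
    with step in_S obtain p where "pre_digraph.awalk G (f u) p (f t)"
      "\<forall>a \<in> set p. activated B x a" by blast
    then show ?case using v activated in_S step.prems
      by (intro exI[of _ "e (s, x v, u) # p"])
        (auto simp: pre_digraph.awalk_def pre_digraph.cas.simps)
  qed
  have "bp_computes k V R g B"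
    unfolding bp_computes_def
  proof (intro conjI is_bp ballI allI impI)
    fix x n assume x: "x \<in> V \<rightarrow>\<^sub>E {1..k}"
    show "\<exists>s r. computation_ends_in B x s \<and> bp_label B s = Final r"
    proof -
      obtain s r where s: "(query_step E lab x)\<^sup>*\<^sup>* s0 s" "lab s = Final r"
        using complete[OF x] by blast
      obtain p where p: "pre_digraph.awalk G (f s0) p (f s)" "\<forall>a \<in> set p. activated B x a"
        using walk_I[OF s(1) root] by blast
      moreover have "s \<in> S"
        using s(1) by induction (use root in_S(3) in \<open>auto simp: query_step_def\<close>)
      \<comment> \<open>A final state is a sink, so a walk reaching it is a complete
        computation.\<close>
      moreover from this have "out_arcs G (f s) = {}"
        using s(2) final_sink by (auto simp: out)
      ultimately show ?thesis
        using s unfolding computation_ends_in_def by (intro exI[of _ "f s"] exI[of _ r]) auto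
    qed
    assume "computation_ends_in B x n"
    then obtain p where p: "pre_digraph.awalk G (f s0) p n" "\<forall>a \<in> set p. activated B x a"
      and stop: "\<forall>a \<in> out_arcs G n. \<not> activated B x a"
      by (auto simp: computation_ends_in_def)
    obtain t where t: "t \<in> S" "n = f t" "(query_step E lab x)\<^sup>*\<^sup>* s0 t"
      using walk_D[OF p root] by blast
    show "bp_label B n = Final (g x) \<or> aborts_at B x n"
    proof (cases "lab t")
      case (Query v)
      \<comment> \<open>An edge carrying the queried value would be activated and the walk could go
        on.\<close>
      have "bp_edge_label B z \<noteq> x v" if z: "z \<in> out_arcs (bp_graph B) n" for z
      proof -
        obtain a u where "z = e (t, a, u)" "(t, a, u) \<in> E"
          using z t out by auto
        then show ?thesis using stop z activated Query by fastforce
      qed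
      then show ?thesis using t Query by (auto simp: aborts_at_def)
    next
      case (Final r)
      then show ?thesis using sound[OF x t(3)] t by simp
    qed
  qed
  moreover have "num_states B = card S"
    using card_image[OF f] by (simp add: num_states_def)
  moreover have "bp_deterministic k B"
    if det: "\<And>s v a. s \<in> S \<Longrightarrow> lab s = Query v \<Longrightarrow> a \<in> {1..k} \<Longrightarrow> \<exists>!t. (s, a, t) \<in> E"
    unfolding bp_deterministic_def
  proof (intro ballI allI impI)
    fix n v assume "n \<in> verts (bp_graph B)" "bp_label B n = Query v"
    then obtain s where s: "n = f s" "s \<in> S" "lab s = Query v" by auto
    note D = det[OF s(2,3)]
    show "bij_betw (bp_edge_label B) (out_arcs (bp_graph B) n) {1..k}"
      unfolding bij_betw_def
    proof
      show "inj_on (bp_edge_label B) (out_arcs (bp_graph B) n)"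
      proof (rule inj_onI)
        fix y z assume "y \<in> out_arcs (bp_graph B) n" "z \<in> out_arcs (bp_graph B) n"
          and "bp_edge_label B y = bp_edge_label B z"
        then obtain a t t' where "y = e (s, a, t)" "(s, a, t) \<in> E" "z = e (s, a, t')" "(s, a, t') \<in> E"
          using s out by auto
        then show "y = z" using D in_S by blast
      qed
      show "bp_edge_label B ` out_arcs (bp_graph B) n = {1..k}"
      proof (intro equalityI subsetI)
        fix a assume "a \<in> {1..k}"
        then obtain t where "(s, a, t) \<in> E" using D by blast
        then show "a \<in> bp_edge_label B ` out_arcs (bp_graph B) n"
          using s by (force simp: out intro!: rev_image_eqI[of "e (s, a, t)"])
      qed (use s out in_S in fastforce)
    qed
  qed
  ultimately show thesis using that by blast
qed

section \<open>Configurations of space-bounded machines\<close>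

text \<open>The start state is inserted because it need not be the target of a transition.\<close>

definition tm_states :: "turing_machine \<Rightarrow> nat set" where
  "tm_states M = insert (start_state M) ((\<lambda>(_, q, _). q) ` transitions M)"

definition tm_symbols :: "turing_machine \<Rightarrow> nat set" where
  "tm_symbols M = insert 0 ((\<lambda>(_, _, b, _). b) ` transitions M)"

text \<open>The input head ranges over \<open>n\<close> cells and two markers. Demanding blanks from
  cell \<open>m\<close> on leaves finitely many tapes.\<close>

definition bounded_configs :: "turing_machine \<Rightarrow> nat \<Rightarrow> nat \<Rightarrow> tm_config set" where
  "bounded_configs M n m = tm_states M \<times> {..n + 1} \<times>
     {T. (\<forall>j<m. T j \<in> tm_symbols M) \<and> (\<forall>j\<ge>m. T j = 0)} \<times> {..<m}"

text \<open>Restriction to the first \<open>m\<close> cells is injective on these tapes, since all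
  other cells are 0.\<close>

lemma bounded_tapes:
  fixes A :: "nat set"
  assumes "finite A"
  shows "finite {T. (\<forall>j<m. T j \<in> A) \<and> (\<forall>j\<ge>m. T j = 0)}" (is "finite ?T")
    and "card {T. (\<forall>j<m. T j \<in> A) \<and> (\<forall>j\<ge>m. T j = 0)} \<le> card A ^ m"
proof -
  have inj: "inj_on (\<lambda>T. restrict T {..<m}) ?T"
  proof (rule inj_onI, rule ext)
    fix T T' :: "nat \<Rightarrow> nat" and j
    assume T: "T \<in> ?T" "T' \<in> ?T" and eq: "restrict T {..<m} = restrict T' {..<m}"
    show "T j = T' j"
      using T fun_cong[OF eq, of j] by (cases "j < m") auto
  qed
  have sub: "(\<lambda>T. restrict T {..<m}) ` ?T \<subseteq> {..<m} \<rightarrow>\<^sub>E A" by (auto split: if_splits)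
  have fin: "finite ({..<m} \<rightarrow>\<^sub>E A)" using assms by (intro finite_PiE) auto
  show "finite ?T" using inj_on_finite[OF inj sub fin] .
  show "card ?T \<le> card A ^ m"
    using card_inj_on_le[OF inj sub fin] by (simp add: card_PiE)
qed

lemma bounded_configs_card:
  assumes "wf_tm M"
  shows "finite (bounded_configs M n m)"
    and "card (bounded_configs M n m) \<le>
      card (tm_states M) * (n + 2) * card (tm_symbols M) ^ m * m"
proof -
  have fin: "finite (tm_states M)" "finite (tm_symbols M)"
    using assms by (auto simp: wf_tm_def tm_states_def tm_symbols_def)
  then show "finite (bounded_configs M n m)"
    using bounded_tapes(1)[OF fin(2), of m] by (auto simp: bounded_configs_def)
  show "card (bounded_configs M n m) \<le>
      card (tm_states M) * (n + 2) * card (tm_symbols M) ^ m * m"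
    unfolding bounded_configs_def card_cartesian_product mult.assoc
    by (intro mult_le_mono bounded_tapes(2) fin) simp_all
qed

text \<open>Writing takes place under the work head, which stays below the space bound, so the cells
  from that bound on remain blank.\<close>

lemma reaches_bounded_configs:
  assumes bd: "tm_space_bounded M s" and "tm_reaches M w c"
  shows "c \<in> bounded_configs M (length w) (s (length w))"
proof -
  have *: "j < s (length w)" if "tm_reaches M w (q, i, T, j)" for q i T j
    using bd that by (auto simp: tm_space_bounded_def)
  have "(tm_step M w)\<^sup>*\<^sup>* (tm_init M) c" using assms(2) by (simp add: tm_reaches_def)
  then show ?thesis
  proof (induction rule: rtranclp_induct)
    case base
    \<comment> \<open>The head position 0 of the initial configuration is itself subject to the
      space bound.\<close>
    have "0 < s (length w)"
      using *[of "start_state M" 0 "\<lambda>_. 0" 0] by (simp add: tm_reaches_def tm_init_def)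
    then show ?case
      by (auto simp: bounded_configs_def tm_init_def tm_states_def tm_symbols_def)
  next
    case (step c c')
    from step(2) show ?case
    proof cases
      case (1 q i T j q' b' m m')
      have "tm_reaches M w c'" using step(1,2) by (simp add: tm_reaches_def)
      then have "move_head m' j < s (length w)" using * 1 by blast
      moreover have "j < s (length w)" using * 1 step(1) by (simp add: tm_reaches_def)
      moreover have "q' \<in> tm_states M" using 1(3) by (force simp: tm_states_def)
      moreover have "b' \<in> tm_symbols M" using 1(3) by (force simp: tm_symbols_def)
      ultimately show ?thesis using step(3) 1 by (auto simp: bounded_configs_def)
    qed
  qed
qed

text \<open>The input enters a step only through the scanned symbol and, where the head is held at
  the right marker, through its length.\<close>

lemma tm_step_cong:
  assumes "tm_step M w c c'" "length w = length w'"
    and "input_at w (fst (snd c)) = input_at w' (fst (snd c))"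
  shows "tm_step M w' c c'"
  using assms(1)
proof cases
  case (1 q i T j q' b' m m')
  then show ?thesis
    using tm_step.intros[of q w' i T j q' b' m m' M] assms(2,3) by simp
qed

lemma tm_step_deterministic:
  assumes "single_valued (transitions M)" "tm_step M w c c'" "tm_step M w c c''"
  shows "c' = c''"
  using assms by (fastforce simp: tm_step.simps dest: single_valuedD)

lemma accept_no_step:
  assumes "wf_tm M" "fst c = accept_state M"
  shows "\<not> tm_step M w c c'"
  using assms by (auto simp: tm_step.simps wf_tm_def)

text \<open>Of two deterministic paths from one point, one extends the other, so two maximal ones
  have the same end. This will turn reaching the right final state into soundness.\<close>

lemma deterministic_normal_form_unique:
  assumes det: "\<And>a b c. R a b \<Longrightarrow> R a c \<Longrightarrow> b = c"
    and "R\<^sup>*\<^sup>* a b" "R\<^sup>*\<^sup>* a c" "\<And>z. \<not> R b z" "\<And>z. \<not> R c z"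
  shows "b = c"
  using assms(2-)
proof (induction rule: converse_rtranclp_induct)
  case base
  then show ?case by (metis converse_rtranclpE)
next
  case (step a a')
  then show ?case by (metis converse_rtranclpE det)
qed

text \<open>If every reachable configuration had a successor, dependent choice would build an
  infinite computation.\<close>

lemma halts_normal_form:
  assumes "tm_halts M w"
  obtains c where "tm_reaches M w c" "\<And>c'. \<not> tm_step M w c c'"
proof (rule ccontr)
  assume "\<not> thesis"
  with that have step: "\<exists>c'. tm_step M w c c'" if "tm_reaches M w c" for c
    using \<open>tm_reaches M w c\<close> by blast
  \<comment> \<open>The clause for \<open>n = 0\<close> makes the chosen sequence begin at the
    initial configuration.\<close>
  have "\<exists>f. \<forall>n. (tm_reaches M w (f n) \<and> (n = 0 \<longrightarrow> f n = tm_init M)) \<and> tm_step M w (f n) (f (Suc n))"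
  proof (rule dependent_nat_choice)
    show "\<exists>c. tm_reaches M w c \<and> (0 = 0 \<longrightarrow> c = tm_init M)"
      by (intro exI[of _ "tm_init M"]) (simp add: tm_reaches_def)
    show "\<exists>c'. (tm_reaches M w c' \<and> (Suc n = 0 \<longrightarrow> c' = tm_init M)) \<and> tm_step M w c c'"
      if c: "tm_reaches M w c \<and> (n = 0 \<longrightarrow> c = tm_init M)" for c n
    proof -
      obtain c' where "tm_step M w c c'" using step c by blast
      then show ?thesis
        using c unfolding tm_reaches_def
        by (intro exI[of _ c']) (auto intro: rtranclp.rtrancl_into_rtrancl)
    qed
  qed
  then show False using assms by (auto simp: tm_halts_def)
qed

section \<open>Polynomial growth of the number of configurations\<close>

text \<open>An exponential of a logarithm is a power: g^(c ln n) = n^(c ln g).\<close>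

lemma exponential_log_polynomial:
  fixes s :: "nat \<Rightarrow> nat" and q g :: nat
  assumes "(\<lambda>n. real (s n)) \<in> O(\<lambda>n. ln (real n))"
  obtains A e where "\<And>n. n \<ge> 1 \<Longrightarrow> q * (n + 2) * g ^ s n * s n \<le> A * n ^ e"
proof -
  obtain c where c: "c > 0" "\<forall>\<^sub>F n in sequentially. norm (real (s n)) \<le> c * norm (ln (real n))"
    using landau_o.bigE[OF assms] by blast
  then obtain N where N: "real (s n) \<le> c * \<bar>ln (real n)\<bar>" if "n \<ge> N" for n
    by (auto simp: eventually_sequentially)
  \<comment> \<open>The maximum with 1 makes \<open>ln G\<close> nonnegative, so that the bound on
    \<open>s n\<close> may be multiplied by it.\<close>
  define G where "G = real (max g 1)"
  define a where "a = nat \<lceil>c\<rceil>"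
  define e where "e = nat \<lceil>c * ln G\<rceil>"
  let ?F = "\<lambda>n. q * (n + 2) * g ^ s n * s n"
  \<comment> \<open>The first summand serves \<open>n \<ge> N\<close>; the sum dominates the
    finitely many values below \<open>N\<close>, where the asymptotic bound may fail.\<close>
  define A where "A = 3 * q * a + (\<Sum>n<N. ?F n)"
  have "?F n \<le> A * n ^ (e + 2)" if n: "n \<ge> 1" for n
  proof (cases "n < N")
    case True
    then have "?F n \<le> (\<Sum>n<N. ?F n)" by (intro member_le_sum) auto
    also have "\<dots> \<le> A * n ^ (e + 2)"
      using n by (simp add: A_def add_mult_distrib trans_le_add2)
    finally show ?thesis .
  next
    case False
    have G: "G \<ge> 1" by (simp add: G_def)
    have s: "real (s n) \<le> c * ln (real n)" using N[of n] False n by simp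
    have "c * ln (real n) \<le> c * real n"
      using c(1) n by (intro mult_left_mono ln_bound) auto
    with s have "real (s n) \<le> c * real n" by linarith
    also have "\<dots> \<le> real a * real n" unfolding a_def by (intro mult_right_mono) (auto, linarith)
    finally have s_le: "s n \<le> a * n" by (metis of_nat_le_iff of_nat_mult)
    have "real (g ^ s n) \<le> G ^ s n" by (simp add: G_def power_mono)
    also have "\<dots> = exp (real (s n) * ln G)"
      using G by (simp add: exp_of_nat_mult)
    also have "\<dots> \<le> exp (c * ln (real n) * ln G)"
      using s G by (intro exp_le_cancel_iff[THEN iffD2] mult_right_mono) auto
    also have "\<dots> = real n powr (c * ln G)" using n by (simp add: powr_def mult.commute mult.left_commute)
    also have "\<dots> \<le> real n powr real e" using n by (intro powr_mono) (auto simp: e_def, linarith)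
    also have "\<dots> = real (n ^ e)" using n by (simp add: powr_realpow)
    finally have "g ^ s n \<le> n ^ e" by (simp only: of_nat_le_iff)
    \<comment> \<open>The bounds \<open>n + 2 \<le> 3 * n\<close> and \<open>s n \<le> a * n\<close>
      contribute the additional 2 in the exponent.\<close>
    then have "?F n \<le> q * (3 * n) * n ^ e * (a * n)"
      using s_le n by (intro mult_le_mono) auto
    also have "\<dots> = 3 * q * a * n ^ (e + 2)" by (simp add: power_add power2_eq_square)
    also have "\<dots> \<le> A * n ^ (e + 2)" by (intro mult_right_mono) (auto simp: A_def)
    finally show ?thesis .
  qed
  then show thesis using that by blast
qed

section \<open>Encodings of tree instances\<close>

lemma product_lists_replicate:
  "set (product_lists (replicate n ys)) = {xs. length xs = n \<and> set xs \<subseteq> set ys}"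
  by (auto simp: product_lists_set list_all2_conv_all_nth in_set_conv_nth subset_iff)
    (metis in_set_conv_nth)

lemma length_product_lists_replicate:
  "length (product_lists (replicate n ys)) = length ys ^ n"
  by (induction n) (simp_all add: length_concat comp_def sum_list_triv)

lemma set_internal_nodes:
  "p \<in> set (internal_nodes d h) \<longleftrightarrow> length p < h - 1 \<and> set p \<subseteq> {0..<d}"
  by (auto simp: internal_nodes_def level_nodes_def product_lists_replicate)

lemma set_leaves: "p \<in> set (leaves d h) \<longleftrightarrow> length p = h - 1 \<and> set p \<subseteq> {0..<d}"
  by (auto simp: leaves_def level_nodes_def product_lists_replicate)

lemma Fun_Var_in_tree_vars:
  "Fun_Var p a \<in> set (tree_vars d h k) \<longleftrightarrow>
     length p < h - 1 \<and> set p \<subseteq> {0..<d} \<and> length a = d \<and> set a \<subseteq> {1..k}"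
  by (auto simp: tree_vars_def set_internal_nodes product_lists_replicate image_iff
      atLeastLessThanSuc_atLeastAtMost)

lemma Leaf_Var_in_tree_vars:
  "Leaf_Var p \<in> set (tree_vars d h k) \<longleftrightarrow> length p = h - 1 \<and> set p \<subseteq> {0..<d}"
  by (auto simp: tree_vars_def set_leaves image_iff)

lemma length_tree_vars:
  "length (tree_vars d h k) = length (internal_nodes d h) * k ^ d + length (leaves d h)"
  by (simp add: tree_vars_def length_concat comp_def length_product_lists_replicate sum_list_triv
      del: upt_Suc)

text \<open>If the children have values in [k], their tuple indexes an actual function variable, and
  it is at such variables that an instance takes values in [k].\<close>

lemma node_value_in_range:
  assumes "x \<in> tree_instances d h k" "length p + l = h - 1" "set p \<subseteq> {0..<d}"
  shows "node_value d x l p \<in> {1..k}"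
  using assms(2,3)
proof (induction l arbitrary: p)
  case 0
  then have "Leaf_Var p \<in> set (tree_vars d h k)" by (simp add: Leaf_Var_in_tree_vars)
  then show ?case using assms(1) by (simp add: tree_instances_def PiE_iff)
next
  case (Suc l)
  have "node_value d x l (p @ [j]) \<in> {1..k}" if "j < d" for j
    using Suc.prems that by (intro Suc.IH) auto
  then have "Fun_Var p (map (\<lambda>j. node_value d x l (p @ [j])) [0..<d]) \<in> set (tree_vars d h k)"
    using Suc.prems by (auto simp: Fun_Var_in_tree_vars)
  then show ?case using assms(1) unfolding node_value.simps tree_instances_def
    by (meson PiE_mem)
qed

lemma FT_in_range: "x \<in> tree_instances d h k \<Longrightarrow> FT d h x \<in> {1..k}"
  unfolding FT_def by (rule node_value_in_range) auto

section \<open>Testing the root value\<close>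

text \<open>Each variable is transformed separately, so a cell of the encoded result still depends
  on one variable only. The value 2 signals failure and lies in [k] for k \<ge> 2.\<close>

fun root_test :: "nat \<Rightarrow> tree_var \<Rightarrow> nat \<Rightarrow> nat" where
  "root_test r (Fun_Var [] a) b = (if b = r then 1 else 2)"
| "root_test r v b = b"

text \<open>The restricted abstraction keeps the result in the extensional function space of
  instances.\<close>

definition test_instance :: "nat \<Rightarrow> nat \<Rightarrow> nat \<Rightarrow> nat \<Rightarrow> (tree_var \<Rightarrow> nat) \<Rightarrow> tree_var \<Rightarrow> nat" where
  "test_instance d h k r x = (\<lambda>v \<in> set (tree_vars d h k). root_test r v (x v))"

lemma test_instance_apply:
  "v \<in> set (tree_vars d h k) \<Longrightarrow> test_instance d h k r x v = root_test r v (x v)"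
  by (simp add: test_instance_def)

lemma root_test_in_range: "2 \<le> k \<Longrightarrow> b \<in> {1..k} \<Longrightarrow> root_test r v b \<in> {1..k}"
  by (cases "(r, v, b)" rule: root_test.cases) auto

lemma test_instance_in_tree_instances:
  assumes "2 \<le> k" "x \<in> tree_instances d h k"
  shows "test_instance d h k r x \<in> tree_instances d h k"
  using assms root_test_in_range unfolding tree_instances_def test_instance_def
  by (simp add: PiE_iff)

lemma root_test_not_root: "root_test r (Leaf_Var p) b = b" "p \<noteq> [] \<Longrightarrow> root_test r (Fun_Var p a) b = b"
  by (simp, cases p) auto

text \<open>The test alters only the function at \<open>[]\<close>, which lies outside the subtree
  below any other node.\<close>

lemma node_value_test_instance:
  assumes x: "x \<in> tree_instances d h k"
    and "length p + l = h - 1" "set p \<subseteq> {0..<d}" "p \<noteq> []"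
  shows "node_value d (test_instance d h k r x) l p = node_value d x l p"
  using assms(2-)
proof (induction l arbitrary: p)
  case 0
  then have "Leaf_Var p \<in> set (tree_vars d h k)" by (simp add: Leaf_Var_in_tree_vars)
  then show ?case by (simp add: test_instance_apply root_test_not_root)
next
  case (Suc l)
  have "node_value d x l (p @ [j]) \<in> {1..k}" if "j < d" for j
    using Suc.prems that by (intro node_value_in_range[OF x]) auto
  then have v: "Fun_Var p (map (\<lambda>j. node_value d x l (p @ [j])) [0..<d]) \<in> set (tree_vars d h k)"
    using Suc.prems by (auto simp: Fun_Var_in_tree_vars)
  have eq: "map (\<lambda>j. node_value d (test_instance d h k r x) l (p @ [j])) [0..<d] =
      map (\<lambda>j. node_value d x l (p @ [j])) [0..<d]"
    using Suc.prems by (intro map_cong refl Suc.IH) auto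
  show ?case
    unfolding node_value.simps eq
    using v Suc.prems by (simp add: test_instance_apply root_test_not_root)
qed

text \<open>With at least two levels the root is internal and its children keep their values, so the
  test is applied to the original root value.\<close>

lemma FT_test_instance:
  assumes x: "x \<in> tree_instances d h k" and h: "2 \<le> h"
  shows "FT d h (test_instance d h k r x) = (if FT d h x = r then 1 else 2)"
proof -
  obtain l where l: "h - 1 = Suc l" using h by (cases "h - 1") auto
  have "node_value d x l ([] @ [j]) \<in> {1..k}" if "j < d" for j
    using l that by (intro node_value_in_range[OF x]) auto
  then have v: "Fun_Var [] (map (\<lambda>j. node_value d x l ([] @ [j])) [0..<d]) \<in> set (tree_vars d h k)"
    using l by (auto simp: Fun_Var_in_tree_vars)
  have eq: "map (\<lambda>j. node_value d (test_instance d h k r x) l ([] @ [j])) [0..<d] =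
      map (\<lambda>j. node_value d x l ([] @ [j])) [0..<d]"
    using l by (intro map_cong refl node_value_test_instance[OF x]) auto
  show ?thesis
    unfolding FT_def l node_value.simps eq using v by (simp add: test_instance_apply)
qed

section \<open>Unique decoding\<close>

lemma length_binary [simp]: "length (binary n m) = n"
  by (simp add: binary_def)

text \<open>Equal lists agree on the bits below \<open>n\<close>, and numbers below 2^n have all
  higher bits zero.\<close>

lemma binary_inject:
  assumes "binary n m = binary n m'" "m < 2 ^ n" "m' < 2 ^ n"
  shows "m = m'"
proof (rule bit_eqI)
  fix i
  have "bit m i = bit m' i" if "i < n"
    using assms(1) that by (auto simp: binary_def)
  moreover have "\<not> bit m i" "\<not> bit m' i" if "n \<le> i"
    using assms(2,3) that by (metis bit_take_bit_iff leD take_bit_nat_eq_self)+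
  ultimately show "bit m i = bit m' i" by (cases "i < n") auto
qed

lemma less_power_floorlog: "m \<le> k \<Longrightarrow> m < 2 ^ floorlog 2 k"
  by (meson floorlog_leD floorlog_mono one_less_numeral_iff semiring_norm(76))

text \<open>Doubling makes the two entries of each pair equal, so the first unequal pair is the
  terminator.\<close>

lemma self_delimiting:
  "concat (map (\<lambda>b. [b, b]) xs) @ [False, True] @ us = concat (map (\<lambda>b. [b, b]) ys) @ [False, True] @ vs
    \<Longrightarrow> xs = ys \<and> us = vs"
proof (induction xs arbitrary: ys)
  case Nil
  then show ?case by (cases ys) auto
next
  case (Cons x xs)
  then show ?case by (cases ys) auto
qed

text \<open>The terminator separates the digits from the rest; equal digit lists have equal length,
  so both numbers were written with the same width.\<close>

lemma encode_param_inject: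
  assumes "encode_param m @ us = encode_param m' @ vs"
  shows "m = m' \<and> us = vs"
proof -
  have eq: "binary (floorlog 2 m) m = binary (floorlog 2 m') m'" "us = vs"
    using self_delimiting[of "binary (floorlog 2 m) m" us "binary (floorlog 2 m') m'" vs] assms
    by (simp_all add: encode_param_def)
  from arg_cong[OF eq(1), of length] have "floorlog 2 m = floorlog 2 m'" by simp
  then show ?thesis
    using eq binary_inject[of "floorlog 2 m" m m'] less_power_floorlog[of m m]
      less_power_floorlog[of m' m'] by simp
qed

lemma length_concat_const:
  "(\<And>v. v \<in> set vs \<Longrightarrow> length (F v) = L) \<Longrightarrow> length (concat (map F vs)) = length vs * L"
  by (induction vs) auto

lemma concat_binary_inject:
  assumes "concat (map (\<lambda>v. binary L (x v)) vs) = concat (map (\<lambda>v. binary L (y v)) vs)"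
    and "\<And>v. v \<in> set vs \<Longrightarrow> x v < 2 ^ L \<and> y v < 2 ^ L" and "v \<in> set vs"
  shows "x v = y v"
  using assms by (induction vs) (auto dest: binary_inject)

text \<open>The parameters are recovered first. They fix the list of variables and the block width,
  and the rest is then compared block by block.\<close>

lemma encode_instance_inject:
  assumes eq: "encode_instance d h k x = encode_instance d h' k' x'"
    and x: "x \<in> tree_instances d h k" and x': "x' \<in> tree_instances d h' k'"
  shows "h = h' \<and> k = k' \<and> x = x'"
proof -
  have hk: "h = h'" "k = k'"
    and body: "concat (map (\<lambda>v. binary (floorlog 2 k) (x v)) (tree_vars d h k)) =
      concat (map (\<lambda>v. binary (floorlog 2 k') (x' v)) (tree_vars d h' k'))"
    using eq unfolding encode_instance_def by (blast dest: encode_param_inject)+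
  have "x v = x' v" if "v \<in> set (tree_vars d h k)" for v
  proof (rule concat_binary_inject[OF _ _ that])
    show "concat (map (\<lambda>v. binary (floorlog 2 k) (x v)) (tree_vars d h k)) =
        concat (map (\<lambda>v. binary (floorlog 2 k) (x' v)) (tree_vars d h k))"
      using body hk by simp
    show "x u < 2 ^ floorlog 2 k \<and> x' u < 2 ^ floorlog 2 k" if "u \<in> set (tree_vars d h k)" for u
      using that x x' hk unfolding tree_instances_def
      by (auto simp: PiE_iff intro: less_power_floorlog)
  qed
  then have "x = x'" using x x' hk unfolding tree_instances_def by (auto intro: PiE_ext)
  with hk show ?thesis by simp
qed

text \<open>By unique decoding the string encodes no other instance, so the root value of the test
  instance decides membership.\<close>

lemma encode_test_instance_in_BT:
  assumes "2 \<le> h" "2 \<le> k" "x \<in> tree_instances d h k"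
  shows "encode_instance d h k (test_instance d h k r x) \<in> BT d \<longleftrightarrow> FT d h x = r"
proof -
  note t = test_instance_in_tree_instances[OF assms(2,3), of r]
  have "encode_instance d h k (test_instance d h k r x) \<in> BT d \<longleftrightarrow>
      FT d h (test_instance d h k r x) = 1"
    using t assms unfolding BT_def by (force dest: encode_instance_inject[OF _ t])
  then show ?thesis using FT_test_instance[OF assms(3,1)] by simp
qed

section \<open>Length of the encoding\<close>

lemma length_encode_param [simp]: "length (encode_param m) = 2 * floorlog 2 m + 2"
  using length_concat_const[of "binary (floorlog 2 m) m" "\<lambda>b. [b, b]" 2]
  by (simp add: encode_param_def)

lemma length_encode_instance:
  "length (encode_instance d h k x) = 2 * floorlog 2 h + 2 * floorlog 2 k + 4 +
     length (tree_vars d h k) * floorlog 2 k"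
  by (simp add: encode_instance_def length_concat_const[where L = "floorlog 2 k"])

text \<open>Each internal node has k^d table entries, and the crude bound
  \<open>floorlog 2 k \<le> k\<close> on their width gives k^(d + 1). The dependence on
  \<open>h\<close> stays in the coefficient.\<close>

lemma length_encode_instance_le:
  assumes "1 \<le> k"
  shows "length (encode_instance d h k x) \<le>
    (2 * h + 6 + length (internal_nodes d h) + length (leaves d h)) * k ^ (d + 1)"
proof -
  have fl: "floorlog 2 m \<le> m" for m :: nat by (intro floorlog_leI) auto
  have k: "1 \<le> k ^ d" "k \<le> k ^ (d + 1)" "1 \<le> k ^ (d + 1)" using assms by simp_all
  have "length (encode_instance d h k x) \<le>
      2 * h + 2 * k + 4 + (length (internal_nodes d h) * k ^ d + length (leaves d h)) * k"
    unfolding length_encode_instance length_tree_vars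
    using fl[of h] fl[of k] by (intro add_mono mult_le_mono) auto
  also have "\<dots> = 2 * h * 1 + 2 * k + 4 * 1 + length (internal_nodes d h) * k ^ (d + 1) +
      length (leaves d h) * k" by (simp add: algebra_simps)
  also have "\<dots> \<le> 2 * h * k ^ (d + 1) + 2 * k ^ (d + 1) + 4 * k ^ (d + 1) +
      length (internal_nodes d h) * k ^ (d + 1) + length (leaves d h) * k ^ (d + 1)"
    using k by (intro add_mono mult_le_mono order_refl)
  also have "\<dots> = (2 * h + 6 + length (internal_nodes d h) + length (leaves d h)) * k ^ (d + 1)"
    by (simp add: algebra_simps)
  finally show ?thesis .
qed

section \<open>Dependence of input cells on variables\<close>

text \<open>All blocks have length \<open>L\<close>, so the block containing position
  \<open>i\<close> does not depend on the assignment. \<open>F\<close> takes the variable as an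
  argument to cover the root test.\<close>

lemma nth_concat_single_dependency:
  assumes "\<And>v a. v \<in> set vs \<Longrightarrow> length (F v a) = L" and "i < length vs * L"
  shows "\<exists>v \<in> set vs. \<forall>x y. x v = y v \<longrightarrow>
    concat (map (\<lambda>v. F v (x v)) vs) ! i = concat (map (\<lambda>v. F v (y v)) vs) ! i"
  using assms
proof (induction vs arbitrary: i)
  case (Cons u vs)
  show ?case
  proof (cases "i < L")
    case True
    then show ?thesis using Cons.prems by (intro bexI[of _ u]) (auto simp: nth_append)
  next
    case False
    then have "i - L < length vs * L" using Cons.prems(2) by auto
    then obtain v where v: "v \<in> set vs" "\<forall>x y. x v = y v \<longrightarrow>
      concat (map (\<lambda>v. F v (x v)) vs) ! (i - L) = concat (map (\<lambda>v. F v (y v)) vs) ! (i - L)"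
      using Cons.IH[of "i - L"] Cons.prems(1) by (meson list.set_intros(2))
    have shift: "concat (map (\<lambda>v. F v (x v)) (u # vs)) ! i = concat (map (\<lambda>v. F v (x v)) vs) ! (i - L)" for x
      using False Cons.prems(1)[of u] by (simp add: nth_append)
    show ?thesis
      unfolding shift by (rule bexI[of _ v], fact v(2)) (use v(1) in simp)
  qed
qed simp

lemma input_at_single_dependency:
  assumes "1 \<le> d"
  shows "\<exists>v \<in> set (tree_vars d h k). \<forall>x y. x v = y v \<longrightarrow>
    input_at (encode_instance d h k (test_instance d h k r x)) i =
    input_at (encode_instance d h k (test_instance d h k r y)) i"
proof -
  let ?vs = "tree_vars d h k" and ?L = "floorlog 2 k"
  define P where "P = encode_param h @ encode_param k"
  define C where "C = (\<lambda>x. concat (map (\<lambda>v. binary ?L (root_test r v (x v))) ?vs))"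
  have enc: "encode_instance d h k (test_instance d h k r x) = P @ C x" for x
    by (auto simp: encode_instance_def test_instance_def P_def C_def intro!: arg_cong[where f = concat])
  have len: "length (C x) = length ?vs * ?L" for x
    unfolding C_def by (rule length_concat_const) simp
  show ?thesis
  proof (cases "length P < i \<and> i \<le> length P + length ?vs * ?L")
    case True
    \<comment> \<open>Cell 0 holds the left marker, so cell \<open>i\<close> shows entry
      \<open>i - 1\<close> of the string.\<close>
    then have "i - 1 - length P < length ?vs * ?L" by auto
    then have "\<exists>v \<in> set ?vs. \<forall>x y. x v = y v \<longrightarrow> C x ! (i - 1 - length P) = C y ! (i - 1 - length P)"
      unfolding C_def by (intro nth_concat_single_dependency[where L = ?L]) simp_all
    moreover have "input_at (P @ C x) i = Bit (C x ! (i - 1 - length P))" for x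
    proof -
      have "\<not> i - 1 < length P" using True by linarith
      then show ?thesis using True len[of x] by (auto simp: input_at_def nth_append)
    qed
    ultimately show ?thesis by (simp only: enc input_symbol.inject)
  next
    case False
    \<comment> \<open>Markers and parameter prefix are the same for all instances, so any variable
      will do; the leftmost leaf is taken.\<close>
    have "Leaf_Var (replicate (h - 1) 0) \<in> set ?vs"
      using assms by (auto simp: Leaf_Var_in_tree_vars)
    moreover have "input_at (P @ C x) i = input_at (P @ C y) i" for x y
      using False len by (auto simp: input_at_def nth_append)
    ultimately show ?thesis unfolding enc by blast
  qed
qed

section \<open>Simulation of a machine by branching programs\<close>

text \<open>\<open>Run r c\<close> is configuration \<open>c\<close> during the test for the value
  \<open>r\<close>; at \<open>Start\<close> the nondeterministic program guesses
  \<open>r\<close>.\<close>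

datatype sim_state = Start | Run nat tm_config | Out nat

text \<open>This isolates what the simulation uses about tree evaluation. \<open>W r x\<close> is
  the string on which \<open>M\<close> tests whether \<open>g x\<close> equals \<open>r\<close>; the
  common length \<open>n\<close> gives one configuration space for all tests.\<close>

locale value_tests =
  fixes M :: turing_machine and s :: "nat \<Rightarrow> nat" and n k :: nat and V :: "'v set"
    and g :: "('v \<Rightarrow> nat) \<Rightarrow> nat" and W :: "nat \<Rightarrow> ('v \<Rightarrow> nat) \<Rightarrow> bool list"
  assumes wf: "wf_tm M" and space: "tm_space_bounded M s"
    and g_range: "x \<in> V \<rightarrow>\<^sub>E {1..k} \<Longrightarrow> g x \<in> {1..k}"
    and length_W: "length (W r x) = n"
    and dependency: "\<exists>v \<in> V. \<forall>x y. x v = y v \<longrightarrow> input_at (W r x) i = input_at (W r y) i"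
    and accepts_iff: "x \<in> V \<rightarrow>\<^sub>E {1..k} \<Longrightarrow> tm_accepts M (W r x) \<longleftrightarrow> g x = r"
    and k_pos: "1 \<le> k"
begin

abbreviation configs :: "tm_config set" where
  "configs \<equiv> bounded_configs M n (s n)"

text \<open>A state of a branching program must query something, so a variable is chosen even if the cell
  under the head depends on none.\<close>

definition query :: "nat \<Rightarrow> tm_config \<Rightarrow> 'v" where
  "query r c = (SOME v. v \<in> V \<and>
     (\<forall>x y. x v = y v \<longrightarrow> input_at (W r x) (fst (snd c)) = input_at (W r y) (fst (snd c))))"

lemma query:
  "query r c \<in> V"
  "x (query r c) = y (query r c) \<Longrightarrow>
     input_at (W r x) (fst (snd c)) = input_at (W r y) (fst (snd c))"
proof -
  have "\<exists>v. v \<in> V \<and>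
     (\<forall>x y. x v = y v \<longrightarrow> input_at (W r x) (fst (snd c)) = input_at (W r y) (fst (snd c)))"
    using dependency[of r "fst (snd c)"] by (rule bexE) (rule exI, rule conjI)
  from someI_ex[OF this] show "query r c \<in> V"
    and "x (query r c) = y (query r c) \<Longrightarrow>
      input_at (W r x) (fst (snd c)) = input_at (W r y) (fst (snd c))"
    unfolding query_def by blast+
qed

text \<open>An edge may depend on the answer \<open>a\<close> but not on the whole input, hence the
  existential quantifier over inputs giving this answer.\<close>

definition step_on :: "nat \<Rightarrow> nat \<Rightarrow> tm_config \<Rightarrow> tm_config \<Rightarrow> bool" where
  "step_on r a c c' \<longleftrightarrow>
     (\<exists>x \<in> V \<rightarrow>\<^sub>E {1..k}. x (query r c) = a \<and> tm_step M (W r x) c c')"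

text \<open>Inputs agreeing at the queried variable show the same symbol under the head, so they
  allow the same steps.\<close>

lemma step_on_iff:
  assumes "x \<in> V \<rightarrow>\<^sub>E {1..k}"
  shows "step_on r (x (query r c)) c c' \<longleftrightarrow> tm_step M (W r x) c c'"
proof
  assume "step_on r (x (query r c)) c c'"
  then obtain y where y: "y (query r c) = x (query r c)" "tm_step M (W r y) c c'"
    by (auto simp: step_on_def)
  from y(1) have "input_at (W r y) (fst (snd c)) = input_at (W r x) (fst (snd c))"
    by (rule query(2))
  then show "tm_step M (W r x) c c'"
    using tm_step_cong[OF y(2), of "W r x"] by (simp add: length_W)
qed (use assms in \<open>auto simp: step_on_def\<close>)

text \<open>\<open>Start\<close> must query as well; its variable is arbitrary, since the guess
  ignores the answer.\<close>

fun label :: "sim_state \<Rightarrow> ('v, nat) state_label" where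
  "label Start = Query (query 1 (tm_init M))"
| "label (Run r c) = Query (query r c)"
| "label (Out r) = Final r"

lemma reaches_configs: "tm_reaches M (W r x) c \<Longrightarrow> c \<in> configs"
  using reaches_bounded_configs[OF space, of "W r x" c] by (simp add: length_W)

lemma init_configs: "tm_init M \<in> configs"
  using reaches_configs[of 1 undefined] by (simp add: tm_reaches_def)

text \<open>The edge set \<open>E\<close> is left open so that the guessing program and the trial
  program can share the induction.\<close>

lemma simulate:
  assumes "tm_reaches M (W r x) c"
    and "\<And>c c'. tm_reaches M (W r x) c \<Longrightarrow> tm_step M (W r x) c c' \<Longrightarrow>
      query_step E label x (Run r c) (Run r c')"
  shows "(query_step E label x)\<^sup>*\<^sup>* (Run r (tm_init M)) (Run r c)"
  using assms(1) unfolding tm_reaches_def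
proof (induction rule: rtranclp_induct)
  case (step c c')
  then show ?case
    using assms(2)[of c c'] by (auto simp: tm_reaches_def intro: rtranclp.rtrancl_into_rtrancl)
qed simp

lemma ex_accepting:
  assumes "x \<in> V \<rightarrow>\<^sub>E {1..k}"
  obtains c where "tm_reaches M (W (g x) x) c" "fst c = accept_state M"
  using accepts_iff[OF assms, of "g x"] by (auto simp: tm_accepts_def)

definition run_states :: "sim_state set" where
  "run_states = case_prod Run ` ({1..k} \<times> configs) \<union> Out ` {1..k}"

lemma Run_in_run_states [simp]: "Run r c \<in> run_states \<longleftrightarrow> r \<in> {1..k} \<and> c \<in> configs"
  and Out_in_run_states [simp]: "Out r \<in> run_states \<longleftrightarrow> r \<in> {1..k}"
  and Start_not_in_run_states [simp]: "Start \<notin> run_states"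
  by (auto simp: run_states_def)

lemma finite_run_states: "finite run_states"
  using bounded_configs_card(1)[OF wf] by (simp add: run_states_def)

lemma card_run_states: "card run_states \<le> k * card configs + k"
proof -
  have "card run_states \<le> card (case_prod Run ` ({1..k} \<times> configs)) + card (Out ` {1..k})"
    unfolding run_states_def by (rule card_Un_le)
  also have "\<dots> \<le> card ({1..k} \<times> configs) + card {1..k}"
    using bounded_configs_card(1)[OF wf] by (intro add_mono card_image_le) auto
  finally show ?thesis by (simp add: card_cartesian_product)
qed

lemma unique_final_run_state:
  assumes "r \<in> {1..k}" "Out r \<in> S"
  shows "\<exists>!q. q \<in> S \<and> label q = Final r"
proof (rule ex1I[of _ "Out r"])
  show "q = Out r" if "q \<in> S \<and> label q = Final r" for q
    using that by (cases q) auto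
qed (use assms in auto)

lemma label_range: "label ` insert Start run_states \<subseteq> Query ` V \<union> Final ` {1..k}"
  using query(1) by (auto simp: run_states_def)

section \<open>The guessing program\<close>

definition guess_edges :: "(sim_state \<times> nat \<times> sim_state) set" where
  "guess_edges =
     {(Start, a, Run r (tm_init M)) | a r. a \<in> {1..k} \<and> r \<in> {1..k}} \<union>
     {(Run r c, a, Run r c') | r c a c'.
        r \<in> {1..k} \<and> c \<in> configs \<and> a \<in> {1..k} \<and> c' \<in> configs \<and> step_on r a c c'} \<union>
     {(Run r c, a, Out r) | r c a.
        r \<in> {1..k} \<and> c \<in> configs \<and> a \<in> {1..k} \<and> fst c = accept_state M}"

text \<open>A wrong guess \<open>r\<close> may run forever or abort but never reaches
  \<open>Out r\<close>, because \<open>M\<close> does not accept \<open>W r x\<close>. The guess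
  \<open>g x\<close> has an accepting run.\<close>

lemma nondeterministic_program:
  obtains B where "bp_computes k V {1..k} g B" "num_states B \<le> k * card configs + k + 1"
proof -
  let ?step = "query_step guess_edges label"
  have sound: "r = g x"
    if x: "x \<in> V \<rightarrow>\<^sub>E {1..k}" and "(?step x)\<^sup>*\<^sup>* Start q" "label q = Final r" for x q r
  proof -
    \<comment> \<open>A running test may have any \<open>r\<close>; only entering
      \<open>Out r\<close> from an accepting configuration forces \<open>r = g x\<close>.\<close>
    define inv where "inv q = (case q of Start \<Rightarrow> True | Run r c \<Rightarrow> tm_reaches M (W r x) c
      | Out r \<Rightarrow> r = g x)" for q
    from that(2) have "inv q"
    proof (induction rule: rtranclp_induct)
      case base
      then show ?case by (simp add: inv_def)
    next
      case (step q q')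
      then obtain v where v: "label q = Query v" "(q, x v, q') \<in> guess_edges"
        by (auto simp: query_step_def)
      from v(2) consider r where "q' = Run r (tm_init M)"
        | r c c' where "q = Run r c" "q' = Run r c'" "step_on r (x v) c c'"
        | r c where "q = Run r c" "q' = Out r" "fst c = accept_state M"
        by (auto simp: guess_edges_def)
      then show ?case
      proof cases
        case 1
        then show ?thesis by (simp add: inv_def tm_reaches_def)
      next
        case 2
        then show ?thesis
          using step.IH v(1) step_on_iff[OF x, of r c c']
          by (auto simp: inv_def tm_reaches_def intro: rtranclp.rtrancl_into_rtrancl)
      next
        case 3
        then have "tm_accepts M (W r x)"
          using step.IH unfolding tm_accepts_def by (intro exI[of _ c]) (simp add: inv_def)
        then show ?thesis using 3 accepts_iff[OF x, of r] by (simp add: inv_def)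
      qed
    qed
    then show ?thesis using that(3) by (cases q) (auto simp: inv_def)
  qed
  have complete: "\<exists>q r. (?step x)\<^sup>*\<^sup>* Start q \<and> label q = Final r"
    if x: "x \<in> V \<rightarrow>\<^sub>E {1..k}" for x
  proof -
    obtain c where c: "tm_reaches M (W (g x) x) c" "fst c = accept_state M"
      using ex_accepting[OF x] .
    have x_range: "x (query r c) \<in> {1..k}" for r c
      using x query(1)[of r c] by (rule PiE_mem)
    have "?step x Start (Run (g x) (tm_init M))"
      using x_range g_range[OF x] by (auto simp: query_step_def guess_edges_def)
    moreover have "(?step x)\<^sup>*\<^sup>* (Run (g x) (tm_init M)) (Run (g x) c)"
    proof (rule simulate[OF c(1)])
      fix c c' assume c: "tm_reaches M (W (g x) x) c" "tm_step M (W (g x) x) c c'"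
      then have "tm_reaches M (W (g x) x) c'"
        by (simp add: tm_reaches_def)
      then show "?step x (Run (g x) c) (Run (g x) c')"
        using c x_range[of "g x" c] g_range[OF x] step_on_iff[OF x, of "g x" c c']
          reaches_configs[of "g x" x c] reaches_configs[of "g x" x c']
        unfolding query_step_def guess_edges_def label.simps by blast
    qed
    moreover have "?step x (Run (g x) c) (Out (g x))"
      using c x_range[of "g x" c] g_range[OF x] reaches_configs[of "g x" x c]
      unfolding query_step_def guess_edges_def label.simps by blast
    ultimately have "(?step x)\<^sup>*\<^sup>* Start (Out (g x))"
      by (meson converse_rtranclp_into_rtranclp rtranclp.rtrancl_into_rtrancl)
    then show ?thesis by (intro exI[of _ "Out (g x)"] exI[of _ "g x"]) simp
  qed
  obtain B where "bp_computes k V {1..k} g B" "num_states B = card (insert Start run_states)"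
  proof (rule branching_program_of_system[of "insert Start run_states" Start guess_edges k label V
        "{1..k}" g])
    show "guess_edges \<subseteq> insert Start run_states \<times> {1..k} \<times> insert Start run_states"
      using init_configs by (auto simp: guess_edges_def)
    show "label q \<noteq> Final r" if "(q, a, t) \<in> guess_edges" for q a t r
      using that by (auto simp: guess_edges_def)
    show "\<exists>!q. q \<in> insert Start run_states \<and> label q = Final r" if "r \<in> {1..k}" for r
      using that by (rule unique_final_run_state) (use that in simp)
  qed (use finite_run_states label_range sound complete in auto)
  then show thesis
    using that card_run_states finite_run_states by simp
qed

section \<open>The trial program\<close>

text \<open>A rejecting halt starts the trial of the next candidate. The default
  \<open>Out k\<close> gives every state a successor for every answer, as a deterministic program
  demands.\<close>

definition next_state :: "nat \<Rightarrow> nat \<Rightarrow> tm_config \<Rightarrow> sim_state" where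
  "next_state r a c =
     (if fst c = accept_state M then Out r
      else if \<exists>c' \<in> configs. step_on r a c c'
        then Run r (SOME c'. c' \<in> configs \<and> step_on r a c c')
      else if r < k then Run (r + 1) (tm_init M) else Out k)"

definition trial_edges :: "(sim_state \<times> nat \<times> sim_state) set" where
  "trial_edges = {(Run r c, a, next_state r a c) | r c a.
     r \<in> {1..k} \<and> c \<in> configs \<and> a \<in> {1..k}}"

lemma next_state_in_run_states:
  assumes "r \<in> {1..k}"
  shows "next_state r a c \<in> run_states"
proof (cases "\<exists>c' \<in> configs. step_on r a c c'")
  case True
  then have "(SOME c'. c' \<in> configs \<and> step_on r a c c') \<in> configs"
    by (metis (mono_tags, lifting) someI_ex)
  then show ?thesis using assms init_configs by (auto simp: next_state_def)
next
  case False
  then show ?thesis using assms init_configs by (auto simp: next_state_def)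
qed

text \<open>The trials of \<open>r < g x\<close> halt without accepting and the trial of
  \<open>g x\<close> accepts, so \<open>Out (g x)\<close> is reached. Since the program is
  deterministic, no other final state is.\<close>

lemma deterministic_program:
  assumes det: "single_valued (transitions M)" and halts: "\<And>w. tm_halts M w"
  obtains B where "bp_computes k V {1..k} g B" "bp_deterministic k B"
    "num_states B \<le> k * card configs + k"
proof -
  let ?step = "query_step trial_edges label"
  let ?root = "Run 1 (tm_init M)"
  have reach: "(?step x)\<^sup>*\<^sup>* ?root (Out (g x))" if x: "x \<in> V \<rightarrow>\<^sub>E {1..k}" for x
  proof -
    have x_range: "x (query r c) \<in> {1..k}" for r c
      using x query(1)[of r c] by (rule PiE_mem)
    have run: "?step x (Run r c) (next_state r (x (query r c)) c)"
      if "r \<in> {1..k}" "tm_reaches M (W r x) c" for r c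
      using that x_range[of r c] reaches_configs[of r x c]
      unfolding query_step_def trial_edges_def label.simps by blast
    have sim: "(?step x)\<^sup>*\<^sup>* (Run r (tm_init M)) (Run r c)"
      if r: "r \<in> {1..k}" and "tm_reaches M (W r x) c" for r c
      using that(2)
    proof (rule simulate)
      fix c c' assume c: "tm_reaches M (W r x) c" "tm_step M (W r x) c c'"
      then have c': "c' \<in> configs"
        by (intro reaches_configs[of r x]) (simp add: tm_reaches_def)
      \<comment> \<open>As \<open>M\<close> is deterministic, the successor picked by
        \<open>SOME\<close> is the actual one.\<close>
      have iff: "step_on r (x (query r c)) c c'' \<longleftrightarrow> c'' = c'" for c''
        using step_on_iff[OF x] c(2) tm_step_deterministic[OF det] by blast
      have "fst c \<noteq> accept_state M" using accept_no_step[OF wf] c(2) by blast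
      then have "next_state r (x (query r c)) c = Run r c'"
        using c' by (auto simp: next_state_def iff intro: some_equality)
      then show "?step x (Run r c) (Run r c')" using run[OF r c(1)] by simp
    qed
    have "(?step x)\<^sup>*\<^sup>* ?root (Run r (tm_init M))" if "1 \<le> r" "r \<le> g x" for r
      using that
    proof (induction r rule: dec_induct)
      case (step r)
      \<comment> \<open>Halting enters here: a failed trial has to end before the next one can
        begin.\<close>
      obtain c where c: "tm_reaches M (W r x) c" "\<And>c'. \<not> tm_step M (W r x) c c'"
        using halts_normal_form[OF halts] by blast
      have "\<not> tm_accepts M (W r x)" using accepts_iff[OF x, of r] step.prems by simp
      then have "fst c \<noteq> accept_state M" using c(1) unfolding tm_accepts_def by blast
      moreover have r: "r \<in> {1..k}" "r < k" using step.prems step.hyps g_range[OF x] by auto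
      ultimately have "next_state r (x (query r c)) c = Run (Suc r) (tm_init M)"
        using c(2) step_on_iff[OF x] by (simp add: next_state_def)
      then have "?step x (Run r c) (Run (Suc r) (tm_init M))"
        using run[OF r(1) c(1)] by simp
      then show ?case
        using step sim[OF r(1) c(1)] by (meson Suc_leD rtranclp.rtrancl_into_rtrancl rtranclp_trans)
    qed simp
    then have "(?step x)\<^sup>*\<^sup>* ?root (Run (g x) (tm_init M))" using g_range[OF x] by simp
    moreover obtain c where c: "tm_reaches M (W (g x) x) c" "fst c = accept_state M"
      using ex_accepting[OF x] .
    moreover have "?step x (Run (g x) c) (Out (g x))"
      using run[OF g_range[OF x] c(1)] c(2) by (simp add: next_state_def)
    ultimately show ?thesis
      using sim[OF g_range[OF x] c(1)] by (meson rtranclp.rtrancl_into_rtrancl rtranclp_trans)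
  qed
  have sound: "r = g x"
    if x: "x \<in> V \<rightarrow>\<^sub>E {1..k}" and q: "(?step x)\<^sup>*\<^sup>* ?root q" "label q = Final r" for x q r
  proof -
    have q_Out: "q = Out r" using q(2) by (cases q) auto
    \<comment> \<open>Final states have no successors, so both paths from the root are
      maximal.\<close>
    have "q = Out (g x)"
    proof (rule deterministic_normal_form_unique[OF _ q(1) reach[OF x]])
      show "b = c" if "?step x a b" "?step x a c" for a b c
        using that by (auto simp: query_step_def trial_edges_def)
    qed (auto simp: q_Out query_step_def)
    then show ?thesis using q_Out by simp
  qed
  obtain B where "bp_computes k V {1..k} g B" "num_states B = card run_states"
    and B: "(\<And>q v a. q \<in> run_states \<Longrightarrow> label q = Query v \<Longrightarrow> a \<in> {1..k} \<Longrightarrow>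
      \<exists>!t. (q, a, t) \<in> trial_edges) \<Longrightarrow> bp_deterministic k B"
  proof (rule branching_program_of_system[of run_states ?root trial_edges k label V "{1..k}" g])
    show "trial_edges \<subseteq> run_states \<times> {1..k} \<times> run_states"
      using next_state_in_run_states by (auto simp: trial_edges_def)
    show "label q \<noteq> Final r" if "(q, a, t) \<in> trial_edges" for q a t r
      using that by (auto simp: trial_edges_def)
    show "\<exists>!q. q \<in> run_states \<and> label q = Final r" if "r \<in> {1..k}" for r
      using that by (rule unique_final_run_state) (use that in simp)
    show "\<exists>q r. (?step x)\<^sup>*\<^sup>* ?root q \<and> label q = Final r" if "x \<in> V \<rightarrow>\<^sub>E {1..k}" for x
      using reach[OF that] by (intro exI[of _ "Out (g x)"] exI[of _ "g x"]) simp
  qed (use finite_run_states label_range sound init_configs k_pos in auto)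
  moreover have "bp_deterministic k B"
  proof (rule B)
    fix q v a assume q: "q \<in> run_states" "label q = Query v" "a \<in> {1..k}"
    then obtain r c where "q = Run r c" "r \<in> {1..k}" "c \<in> configs"
      by (cases q) auto
    then show "\<exists>!t. (q, a, t) \<in> trial_edges"
      using q(3) unfolding trial_edges_def by blast
  qed
  ultimately show thesis
    using that card_run_states by simp
qed

end

section \<open>Polynomial bounds for tree evaluation\<close>

text \<open>The assignment \<open>x0\<close> is arbitrary, since the length of an encoding depends
  on \<open>d\<close>, \<open>h\<close> and \<open>k\<close> alone.\<close>

lemma value_tests_tree:
  assumes "2 \<le> d" "2 \<le> h" "2 \<le> k" "wf_tm M" "tm_space_bounded M s"
    and M: "\<And>w. tm_accepts M w \<longleftrightarrow> w \<in> BT d"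
  shows "value_tests M s (length (encode_instance d h k x0)) k (set (tree_vars d h k)) (FT d h)
    (\<lambda>r x. encode_instance d h k (test_instance d h k r x))"
proof
  fix x :: "tree_var \<Rightarrow> nat" and r i :: nat
  assume x: "x \<in> set (tree_vars d h k) \<rightarrow>\<^sub>E {1..k}"
  then show "FT d h x \<in> {1..k}" by (simp only: FT_in_range flip: tree_instances_def)
  show "tm_accepts M (encode_instance d h k (test_instance d h k r x)) \<longleftrightarrow> FT d h x = r"
    unfolding M using x assms by (intro encode_test_instance_in_BT) (simp_all add: tree_instances_def)
qed (use assms input_at_single_dependency[of d h k] in \<open>auto simp: length_encode_instance\<close>)

text \<open>\<open>A\<close> and \<open>e\<close> depend on the machine alone; this keeps the final
  exponent of \<open>k\<close> independent of \<open>h\<close>.\<close>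

lemma log_space_config_bound:
  assumes "log_space_tm M"
  obtains s A e where "tm_space_bounded M s"
    "\<And>n. n \<ge> 1 \<Longrightarrow> card (bounded_configs M n (s n)) \<le> A * n ^ e"
proof -
  obtain s where s: "wf_tm M" "tm_space_bounded M s" "(\<lambda>n. real (s n)) \<in> O(\<lambda>n. ln (real n))"
    using assms by (auto simp: log_space_tm_def)
  obtain A e where "\<And>n. n \<ge> 1 \<Longrightarrow>
      card (tm_states M) * (n + 2) * card (tm_symbols M) ^ s n * s n \<le> A * n ^ e"
    using exponential_log_polynomial[OF s(3)] by blast
  then have "card (bounded_configs M n (s n)) \<le> A * n ^ e" if "n \<ge> 1" for n
    using bounded_configs_card(2)[OF s(1), of n "s n"] that le_trans by blast
  with s(2) that show thesis by blast
qed

text \<open>\<open>G\<close> will carry the dependence on \<open>h\<close>, which thus stays in the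
  coefficient. The added 2 absorbs \<open>k + 1\<close>.\<close>

lemma state_count_polynomial:
  fixes A C G N e m k :: nat
  assumes "C \<le> A * N ^ e" "N \<le> G * k ^ m" "1 \<le> k"
  shows "k * C + k + 1 \<le> (A * G ^ e + 2) * k ^ (m * e + 1)"
proof -
  have "C \<le> A * (G * k ^ m) ^ e"
    using assms(1) mult_le_mono2[OF power_mono[OF assms(2), of e], of A] by linarith
  then have "k * C \<le> k * (A * (G * k ^ m) ^ e)" by simp
  also have "\<dots> = A * G ^ e * k ^ (m * e + 1)" by (simp add: power_mult_distrib power_mult)
  finally have "k * C \<le> A * G ^ e * k ^ (m * e + 1)" .
  moreover have "k \<le> k ^ (m * e + 1)" "1 \<le> k ^ (m * e + 1)" using assms(3) by simp_all
  ultimately show ?thesis by (simp only: add_mult_distrib)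
qed

theorem theorem3p2:
  fixes d :: nat
  assumes "d \<ge> 2"
  shows "(BT d \<in> LOGSPACE \<longrightarrow>
            (\<exists>(c :: nat) (f :: nat \<Rightarrow> nat). \<forall>h\<ge>2. \<forall>k\<ge>2. detFstates d h k \<le> f h * k ^ c)) \<and>
         (BT d \<in> NLOGSPACE \<longrightarrow>
            (\<exists>(c :: nat) (f :: nat \<Rightarrow> nat). \<forall>h\<ge>2. \<forall>k\<ge>2. ndetFstates d h k \<le> f h * k ^ c))"
proof -
  define G where "G h = 2 * h + 6 + length (internal_nodes d h) + length (leaves d h)" for h
  \<comment> \<open>The zero assignment is a placeholder, not an instance; only the length
    matters.\<close>
  define N where "N h k = length (encode_instance d h k (\<lambda>_. 0))" for h k
  have N: "N h k \<le> G h * k ^ (d + 1)" "1 \<le> N h k" if "2 \<le> k" for h k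
    using length_encode_instance_le[of k d h] that
    by (simp_all add: N_def G_def length_encode_instance)
  have det: "\<exists>(c :: nat) (f :: nat \<Rightarrow> nat). \<forall>h\<ge>2. \<forall>k\<ge>2. detFstates d h k \<le> f h * k ^ c"
    if BT: "BT d \<in> LOGSPACE"
  proof -
    obtain M where M: "log_space_tm M" "single_valued (transitions M)" "\<And>w. tm_halts M w"
      "\<And>w. tm_accepts M w \<longleftrightarrow> w \<in> BT d"
      using BT by (auto simp: LOGSPACE_def)
    then have wf: "wf_tm M" by (simp add: log_space_tm_def)
    obtain s A e where s: "tm_space_bounded M s"
      and card: "\<And>n. n \<ge> 1 \<Longrightarrow> card (bounded_configs M n (s n)) \<le> A * n ^ e"
      using log_space_config_bound[OF M(1)] by blast
    have "detFstates d h k \<le> (A * G h ^ e + 2) * k ^ ((d + 1) * e + 1)" if hk: "2 \<le> h" "2 \<le> k" for h k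
    proof -
      interpret value_tests M s "N h k" k "set (tree_vars d h k)" "FT d h"
        "\<lambda>r x. encode_instance d h k (test_instance d h k r x)"
        unfolding N_def by (rule value_tests_tree[OF assms hk wf s M(4)])
      obtain B where "bp_computes k (set (tree_vars d h k)) {1..k} (FT d h) B" "bp_deterministic k B"
        and B: "num_states B \<le> k * card configs + k"
        using deterministic_program[OF M(2,3)] .
      then have "detFstates d h k \<le> num_states B"
        unfolding detFstates_def by (intro Least_le) blast
      also have "\<dots> \<le> k * card configs + k + 1" using B by simp
      also have "\<dots> \<le> (A * G h ^ e + 2) * k ^ ((d + 1) * e + 1)"
        using card N[OF hk(2)] hk by (intro state_count_polynomial[of _ A "N h k"]) auto
      finally show ?thesis .
    qed
    then show ?thesis
      by (intro exI[of _ "(d + 1) * e + 1"] exI[of _ "\<lambda>h. A * G h ^ e + 2"]) blast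
  qed
  have ndet: "\<exists>(c :: nat) (f :: nat \<Rightarrow> nat). \<forall>h\<ge>2. \<forall>k\<ge>2. ndetFstates d h k \<le> f h * k ^ c"
    if BT: "BT d \<in> NLOGSPACE"
  proof -
    obtain M where M: "log_space_tm M" "\<And>w. tm_accepts M w \<longleftrightarrow> w \<in> BT d"
      using BT by (auto simp: NLOGSPACE_def)
    then have wf: "wf_tm M" by (simp add: log_space_tm_def)
    obtain s A e where s: "tm_space_bounded M s"
      and card: "\<And>n. n \<ge> 1 \<Longrightarrow> card (bounded_configs M n (s n)) \<le> A * n ^ e"
      using log_space_config_bound[OF M(1)] by blast
    have "ndetFstates d h k \<le> (A * G h ^ e + 2) * k ^ ((d + 1) * e + 1)" if hk: "2 \<le> h" "2 \<le> k" for h k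
    proof -
      interpret value_tests M s "N h k" k "set (tree_vars d h k)" "FT d h"
        "\<lambda>r x. encode_instance d h k (test_instance d h k r x)"
        unfolding N_def by (rule value_tests_tree[OF assms hk wf s M(2)])
      obtain B where "bp_computes k (set (tree_vars d h k)) {1..k} (FT d h) B"
        and B: "num_states B \<le> k * card configs + k + 1"
        using nondeterministic_program .
      then have "ndetFstates d h k \<le> num_states B"
        unfolding ndetFstates_def by (intro Least_le) blast
      also note B
      also have "k * card configs + k + 1 \<le> (A * G h ^ e + 2) * k ^ ((d + 1) * e + 1)"
        using card N[OF hk(2)] hk by (intro state_count_polynomial[of _ A "N h k"]) auto
      finally show ?thesis .
    qed
    then show ?thesis
      by (intro exI[of _ "(d + 1) * e + 1"] exI[of _ "\<lambda>h. A * G h ^ e + 2"]) blast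
  qed
  from det ndet show ?thesis by blast
qed

end
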